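(* Let $k$ be a $\sigma\partial$-field such that $k^\sigma$ is differentially closed (with respect to $\partial$), and let $S \supset k$ be a $\sigma\partial$-ring such that $S^\sigma = k^\sigma$. Let $a_1,\ldots,a_n \in k$ and let $z_1,\ldots,z_n\in S$ satisfy $$\sigma(z_i) - z_i = a_i, \qquad i=1,\ldots,n.$$ Then $z_1,\ldots,z_n$ are differentially dependent over $k$ if and only if there exist a nonzero homogeneous linear differential polynomial $L(Y_1,\ldots,Y_n)$ with coefficients in $k^\sigma$ and an element $f\in k$ such that $$L(a_1,\ldots,a_n) = \sigma(f) - f.$$
   Context: All fields have characteristic $0$. A $\sigma\partial$-ring is a commutative ring $R$ with unit together with an automorphism $\sigma$ and a derivation $\partial$ with $\sigma(\partial(r))=\partial(\sigma(r))$ for all $r\in R$; a $\sigma\partial$-field is a $\sigma\partial$-ring that is a field. An inclusion $k\subset S$ of $\sigma\partial$-rings is understood to be compatible with $\sigma$ and $\partial$. $R^\sigma=\{c\in R : \sigma(c)=c\}$; $k^\sigma$ is a differential field with derivation $\partial$. For differential rings $k\subset S$, elements $z_1,\ldots,z_n\in S$ are differentially dependent over $k$ if there is a nonzero differential polynomial $P\in k\{Y_1,\ldots,Y_n\}$ (a polynomial in the variables $Y_i^{(j)}$, $j\ge 0$) with $P(z_1,\ldots,z_n)=0$, where $Y_i^{(j)}$ is evaluated as $\partial^j(z_i)$. A homogeneous linear differential polynomial is a linear form (finite linear combination) in the variables $Y_i^{(j)}$. *)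

theory Defs
  imports "HOL-Library.Poly_Mapping" "HOL-Algebra.Ring"
begin

section \<open>Difference-differential rings\<close>

definition ring_automorphism :: "('a::comm_ring_1 \<Rightarrow> 'a) \<Rightarrow> bool" where
  "ring_automorphism \<sigma> \<longleftrightarrow> bij \<sigma> \<and> \<sigma> 1 = 1 \<and>
     (\<forall>x y. \<sigma> (x + y) = \<sigma> x + \<sigma> y) \<and> (\<forall>x y. \<sigma> (x * y) = \<sigma> x * \<sigma> y)"

definition derivation :: "('a::comm_ring_1 \<Rightarrow> 'a) \<Rightarrow> bool" where
  "derivation \<delta> \<longleftrightarrow>
     (\<forall>x y. \<delta> (x + y) = \<delta> x + \<delta> y) \<and> (\<forall>x y. \<delta> (x * y) = \<delta> x * y + x * \<delta> y)"

definition sigma_delta_ring :: "('a::comm_ring_1 \<Rightarrow> 'a) \<Rightarrow> ('a \<Rightarrow> 'a) \<Rightarrow> bool" where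
  "sigma_delta_ring \<sigma> \<delta> \<longleftrightarrow>
     ring_automorphism \<sigma> \<and> derivation \<delta> \<and> (\<forall>r. \<sigma> (\<delta> r) = \<delta> (\<sigma> r))"

definition sigma_delta_inclusion ::
  "('a::comm_ring_1 \<Rightarrow> 'a) \<Rightarrow> ('a \<Rightarrow> 'a) \<Rightarrow> ('b::comm_ring_1 \<Rightarrow> 'b) \<Rightarrow> ('b \<Rightarrow> 'b) \<Rightarrow> ('a \<Rightarrow> 'b) \<Rightarrow> bool"
  where
  "sigma_delta_inclusion \<sigma> \<delta> \<sigma>' \<delta>' \<iota> \<longleftrightarrow> inj \<iota> \<and> \<iota> 1 = 1 \<and>
     (\<forall>x y. \<iota> (x + y) = \<iota> x + \<iota> y) \<and> (\<forall>x y. \<iota> (x * y) = \<iota> x * \<iota> y) \<and>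
     (\<forall>x. \<iota> (\<sigma> x) = \<sigma>' (\<iota> x)) \<and> (\<forall>x. \<iota> (\<delta> x) = \<delta>' (\<iota> x))"

definition invariants :: "('a \<Rightarrow> 'a) \<Rightarrow> 'a set" where
  "invariants \<sigma> = {c. \<sigma> c = c}"


section \<open>Differential polynomials\<close>

text \<open>The pair \<open>(i, j)\<close> stands for the variable \<open>Y\<^sub>i\<^sup>(\<^sup>j\<^sup>)\<close>; a finitely supported map from such
  pairs to exponents is a monomial.\<close>

type_synonym 'a diff_poly = "(nat \<times> nat \<Rightarrow>\<^sub>0 nat) \<Rightarrow>\<^sub>0 'a"

text \<open>\<open>diff_polys C n\<close> is \<open>C{Y\<^sub>1,\<dots>,Y\<^sub>n}\<close>.\<close>

definition diff_polys :: "'a::zero set \<Rightarrow> nat \<Rightarrow> 'a diff_poly set" where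
  "diff_polys C n =
     {P. \<forall>m \<in> Poly_Mapping.keys P. Poly_Mapping.lookup P m \<in> C \<and>
           Poly_Mapping.keys m \<subseteq> {1..n} \<times> UNIV}"

text \<open>Evaluation at \<open>z\<close>; the coefficients are mapped into the target ring by \<open>h\<close>.\<close>

definition diff_eval ::
  "('a::zero \<Rightarrow> 'b::comm_ring_1) \<Rightarrow> ('b \<Rightarrow> 'b) \<Rightarrow> 'a diff_poly \<Rightarrow> (nat \<Rightarrow> 'b) \<Rightarrow> 'b" where
  "diff_eval h \<delta> P z =
     (\<Sum>m \<in> Poly_Mapping.keys P. h (Poly_Mapping.lookup P m) *
        (\<Prod>(i, j) \<in> Poly_Mapping.keys m. ((\<delta> ^^ j) (z i)) ^ Poly_Mapping.lookup m (i, j)))"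

definition differentially_dependent ::
  "('a::zero \<Rightarrow> 'b::comm_ring_1) \<Rightarrow> ('b \<Rightarrow> 'b) \<Rightarrow> nat \<Rightarrow> (nat \<Rightarrow> 'b) \<Rightarrow> bool" where
  "differentially_dependent \<iota> \<delta> n z \<longleftrightarrow>
     (\<exists>P \<in> diff_polys UNIV n. P \<noteq> 0 \<and> diff_eval \<iota> \<delta> P z = 0)"

definition homogeneous_linear :: "'a::zero diff_poly \<Rightarrow> bool" where
  "homogeneous_linear L \<longleftrightarrow>
     (\<forall>m \<in> Poly_Mapping.keys L. \<exists>v. m = Poly_Mapping.single v 1)"


section \<open>Differentially closed fields\<close>

text \<open>Extension fields have to be quantified over inside a formula, so they are given by carriers,
  as records of HOL-Algebra. The following is \<^const>\<open>diff_eval\<close> for such a field.\<close>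

definition diff_eval_in ::
  "('l, 'x) ring_scheme \<Rightarrow> ('a::zero \<Rightarrow> 'l) \<Rightarrow> ('l \<Rightarrow> 'l) \<Rightarrow> 'a diff_poly \<Rightarrow> (nat \<Rightarrow> 'l) \<Rightarrow> 'l" where
  "diff_eval_in L h \<delta> P z =
     (\<Oplus>\<^bsub>L\<^esub>m \<in> Poly_Mapping.keys P. h (Poly_Mapping.lookup P m) \<otimes>\<^bsub>L\<^esub>
        (\<Otimes>\<^bsub>L\<^esub>v \<in> Poly_Mapping.keys m.
           ((\<delta> ^^ snd v) (z (fst v))) [^]\<^bsub>L\<^esub> Poly_Mapping.lookup m v))"

text \<open>\<open>(L, \<delta>')\<close> is a differential field and \<open>h\<close> embeds the differential field \<open>(C, \<delta>)\<close> into it;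
  injectivity of \<open>h\<close> is automatic.\<close>

definition diff_field_extension ::
  "'a::field set \<Rightarrow> ('a \<Rightarrow> 'a) \<Rightarrow> ('l, 'x) ring_scheme \<Rightarrow> ('l \<Rightarrow> 'l) \<Rightarrow> ('a \<Rightarrow> 'l) \<Rightarrow> bool" where
  "diff_field_extension C \<delta> L \<delta>' h \<longleftrightarrow> field L \<and>
     \<delta>' \<in> carrier L \<rightarrow> carrier L \<and>
     (\<forall>x \<in> carrier L. \<forall>y \<in> carrier L.
        \<delta>' (x \<oplus>\<^bsub>L\<^esub> y) = \<delta>' x \<oplus>\<^bsub>L\<^esub> \<delta>' y \<and>
        \<delta>' (x \<otimes>\<^bsub>L\<^esub> y) = (\<delta>' x \<otimes>\<^bsub>L\<^esub> y) \<oplus>\<^bsub>L\<^esub> (x \<otimes>\<^bsub>L\<^esub> \<delta>' y)) \<and>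
     h \<in> C \<rightarrow> carrier L \<and> h 1 = \<one>\<^bsub>L\<^esub> \<and>
     (\<forall>x \<in> C. \<forall>y \<in> C. h (x + y) = h x \<oplus>\<^bsub>L\<^esub> h y \<and> h (x * y) = h x \<otimes>\<^bsub>L\<^esub> h y) \<and>
     (\<forall>x \<in> C. h (\<delta> x) = \<delta>' (h x))"

text \<open>A differential field \<open>(C, \<delta>)\<close> is differentially closed if every finite system
  \<open>P\<^sub>1 = \<dots> = P\<^sub>r = 0, Q \<noteq> 0\<close> over \<open>C\<close> which has a solution in some differential field extension
  has a solution in \<open>C\<close>. It is no restriction that the elements of the extension \<open>L\<close> are
  drawn from the type of the elements of \<open>C\<close>: the differential field generated over \<open>C\<close> by a
  solution is obtained from \<open>C\<close> and finitely many elements by countably many applications of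
  finitary operations, so for infinite \<open>C\<close> (in particular, in characteristic 0) it has the
  cardinality of \<open>C\<close> and hence an isomorphic copy whose carrier consists of elements of \<open>C\<close>.\<close>

definition differentially_closed :: "'a::field set \<Rightarrow> ('a \<Rightarrow> 'a) \<Rightarrow> bool" where
  "differentially_closed C \<delta> \<longleftrightarrow>
     (\<forall>n F Q. finite F \<and> F \<subseteq> diff_polys C n \<and> Q \<in> diff_polys C n \<and>
        (\<exists>(L :: 'a ring) \<delta>' h w. diff_field_extension C \<delta> L \<delta>' h \<and>
           (\<forall>i \<in> {1..n}. w i \<in> carrier L) \<and>
           (\<forall>P \<in> F. diff_eval_in L h \<delta>' P w = \<zero>\<^bsub>L\<^esub>) \<and> diff_eval_in L h \<delta>' Q w \<noteq> \<zero>\<^bsub>L\<^esub>) \<longrightarrow>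
        (\<exists>w. (\<forall>i \<in> {1..n}. w i \<in> C) \<and>
           (\<forall>P \<in> F. diff_eval id \<delta> P w = 0) \<and> diff_eval id \<delta> Q w \<noteq> 0))"

end

theory Submission
  imports Defs
begin

text \<open>Put \<open>x\<^sub>v = \<partial>\<^sup>j z\<^sub>i\<close> and \<open>b\<^sub>v = \<partial>\<^sup>j a\<^sub>i\<close> for \<open>v = (i, j)\<close>, so that \<open>\<sigma>\<close> translates \<open>x\<close> by \<open>b\<close>. If
  \<open>P(x) = 0\<close>, then \<open>Q(x) = 0\<close> for \<open>Q = P\<^sup>\<sigma>(X + b)\<close>. Choose a nonzero relation \<open>P\<close> of minimal total
  degree \<open>d\<close>, then with the fewest monomials of degree \<open>d\<close>, and with one of their coefficients equal to
  1. The relation \<open>Q - P\<close> lacks that monomial, so \<open>Q = P\<close> by minimality. Hence the coefficients \<open>p\<^sub>m\<close> in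
  degree \<open>d\<close> are invariant, and comparing coefficients at a monomial \<open>k\<close> of degree \<open>d - 1\<close> gives
  \<open>p\<^sub>k = \<sigma>(p\<^sub>k) + \<Sum>\<^sub>v (k\<^sub>v + 1) p\<^bsub>k+v\<^esub> b\<^sub>v\<close>, the required linear identity with \<open>f = - p\<^sub>k\<close>; it is nontrivial
  if \<open>k\<close> divides a monomial of degree \<open>d\<close> of \<open>P\<close>. Conversely, \<open>L(a) = \<sigma>(f) - f\<close> makes \<open>L(z) - f\<close>
  invariant, hence an element of \<open>k\<^sup>\<sigma>\<close>.\<close>

section \<open>Monomials and evaluation\<close>

abbreviation Var :: "'v \<Rightarrow> 'v \<Rightarrow>\<^sub>0 nat" where
  "Var v \<equiv> Poly_Mapping.single v (Suc 0)"

lemma Var_eq_iff [simp]: "Var u = Var v \<longleftrightarrow> u = v"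
  by (metis keys_single nat.distinct(1) singleton_inject)

definition total_deg :: "('v \<Rightarrow>\<^sub>0 nat) \<Rightarrow> nat" where
  "total_deg m = (\<Sum>v\<in>Poly_Mapping.keys m. Poly_Mapping.lookup m v)"

definition mono_eval :: "('v \<Rightarrow> 's::comm_ring_1) \<Rightarrow> ('v \<Rightarrow>\<^sub>0 nat) \<Rightarrow> 's" where
  "mono_eval x m = (\<Prod>v\<in>Poly_Mapping.keys m. x v ^ Poly_Mapping.lookup m v)"

text \<open>The derivation is left out: derivatives of the unknowns count as independent variables,
  indexed by an arbitrary type.\<close>

definition poly_eval ::
  "('k::zero \<Rightarrow> 's::comm_ring_1) \<Rightarrow> ('v \<Rightarrow> 's) \<Rightarrow> (('v \<Rightarrow>\<^sub>0 nat) \<Rightarrow>\<^sub>0 'k) \<Rightarrow> 's" where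
  "poly_eval h x P =
     (\<Sum>m\<in>Poly_Mapping.keys P. h (Poly_Mapping.lookup P m) * mono_eval x m)"

definition deg_bounded :: "'v set \<Rightarrow> nat \<Rightarrow> (('v \<Rightarrow>\<^sub>0 nat) \<Rightarrow>\<^sub>0 'k::zero) \<Rightarrow> bool" where
  "deg_bounded V d P \<longleftrightarrow>
     (\<forall>m\<in>Poly_Mapping.keys P. total_deg m \<le> d \<and> Poly_Mapping.keys m \<subseteq> V)"

lemma diff_eval_eq_poly_eval:
  "diff_eval h \<delta> P z = poly_eval h (\<lambda>(i, j). (\<delta> ^^ j) (z i)) P"
  unfolding diff_eval_def poly_eval_def mono_eval_def
  by (intro sum.cong arg_cong2[where f="(*)"] prod.cong) auto

lemma poly_mapping_eq_sum_single:
  "P = (\<Sum>m\<in>Poly_Mapping.keys P. Poly_Mapping.single m (Poly_Mapping.lookup P m))"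
  by (rule poly_mapping_eqI)
     (simp add: lookup_sum lookup_single when_def in_keys_iff)

lemma keys_plus_nat:
  "Poly_Mapping.keys (m + m' :: 'v \<Rightarrow>\<^sub>0 nat) = Poly_Mapping.keys m \<union> Poly_Mapping.keys m'"
  by (auto simp: in_keys_iff lookup_add)

lemma total_deg_zero [simp]: "total_deg 0 = 0"
  by (simp add: total_deg_def)

lemma total_deg_single [simp]: "total_deg (Poly_Mapping.single v e) = e"
  by (simp add: total_deg_def)

lemma total_deg_plus [simp]: "total_deg (m + m') = total_deg m + total_deg m'"
  unfolding total_deg_def by (rule setsum_keys_plus_distrib) auto

lemma total_deg_eq_0_iff [simp]: "total_deg m = 0 \<longleftrightarrow> m = 0"
  by (auto simp: total_deg_def in_keys_iff intro!: poly_mapping_eqI)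

lemma obtain_var_factor:
  assumes "v \<in> Poly_Mapping.keys m"
  obtains k where "m = k + Var v"
proof
  \<comment> \<open>Subtraction of exponents is truncated, but \<open>v\<close> has exponent at
    least 1.\<close>
  show "m = (m - Var v) + Var v"
    using assms
    by (intro poly_mapping_eqI) (auto simp: lookup_add lookup_minus lookup_single when_def in_keys_iff)
qed

lemma mono_eval_superset:
  assumes "finite A" "Poly_Mapping.keys m \<subseteq> A"
  shows "mono_eval x m = (\<Prod>v\<in>A. x v ^ Poly_Mapping.lookup m v)"
  unfolding mono_eval_def using assms
  by (intro prod.mono_neutral_left) (auto simp: in_keys_iff)

lemma mono_eval_zero [simp]: "mono_eval x 0 = 1"
  by (simp add: mono_eval_def)

lemma mono_eval_single [simp]: "mono_eval x (Poly_Mapping.single v e) = x v ^ e"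
  by (simp add: mono_eval_def)

lemma mono_eval_plus: "mono_eval x (m + m') = mono_eval x m * mono_eval x m'"
proof -
  let ?A = "Poly_Mapping.keys m \<union> Poly_Mapping.keys m'"
  have "mono_eval x k = (\<Prod>v\<in>?A. x v ^ Poly_Mapping.lookup k v)" if "k \<in> {m, m', m + m'}" for k
    using that by (intro mono_eval_superset) (auto simp: keys_plus_nat)
  then show ?thesis
    by (simp add: lookup_add power_add prod.distrib)
qed

section \<open>Coefficients of products with a single term\<close>

lemma lookup_times_single:
  fixes P :: "('v \<Rightarrow>\<^sub>0 nat) \<Rightarrow>\<^sub>0 'k::comm_ring_1"
  shows "Poly_Mapping.lookup (P * Poly_Mapping.single t c) k =
    (\<Sum>m\<in>Poly_Mapping.keys P. Poly_Mapping.lookup P m * c when m + t = k)"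
proof -
  have "P * Poly_Mapping.single t c =
      (\<Sum>m\<in>Poly_Mapping.keys P. Poly_Mapping.single (m + t) (Poly_Mapping.lookup P m * c))"
    by (subst poly_mapping_eq_sum_single[of P]) (simp add: sum_distrib_right mult_single)
  then show ?thesis
    by (simp add: lookup_sum lookup_single)
qed

lemma lookup_times_single_plus:
  fixes P :: "('v \<Rightarrow>\<^sub>0 nat) \<Rightarrow>\<^sub>0 'k::comm_ring_1"
  shows "Poly_Mapping.lookup (P * Poly_Mapping.single t c) (k + t) = Poly_Mapping.lookup P k * c"
  by (simp add: lookup_times_single when_def in_keys_iff)

lemma lookup_times_const:
  fixes P :: "('v \<Rightarrow>\<^sub>0 nat) \<Rightarrow>\<^sub>0 'k::comm_ring_1"
  shows "Poly_Mapping.lookup (P * Poly_Mapping.single 0 c) k = Poly_Mapping.lookup P k * c"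
  using lookup_times_single_plus[of P 0 c k] by simp

text \<open>A variable of exponent 0 in \<open>k\<close> does not divide \<open>k\<close>, so no
  term of the product lands there.\<close>

lemma lookup_times_var_eq_0:
  fixes P :: "('v \<Rightarrow>\<^sub>0 nat) \<Rightarrow>\<^sub>0 'k::comm_ring_1"
  assumes "Poly_Mapping.lookup k v = 0"
  shows "Poly_Mapping.lookup (P * Poly_Mapping.single (Var v) c) k = 0"
  unfolding lookup_times_single using assms
  by (intro sum.neutral) (auto simp: when_def lookup_add)

section \<open>Bounds on degree and variables\<close>

lemma deg_bounded_zero [simp]: "deg_bounded V d 0"
  by (simp add: deg_bounded_def)

lemma deg_bounded_plus:
  "deg_bounded V d P \<Longrightarrow> deg_bounded V d Q \<Longrightarrow> deg_bounded V d (P + Q)"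
  using keys_add[of P Q] unfolding deg_bounded_def by blast

lemma deg_bounded_minus:
  fixes P Q :: "('v \<Rightarrow>\<^sub>0 nat) \<Rightarrow>\<^sub>0 'k::comm_ring_1"
  shows "deg_bounded V d P \<Longrightarrow> deg_bounded V d Q \<Longrightarrow> deg_bounded V d (P - Q)"
  using keys_diff[of P Q] unfolding deg_bounded_def by blast

lemma deg_bounded_mono:
  "deg_bounded V d P \<Longrightarrow> d \<le> e \<Longrightarrow> deg_bounded V e P"
  unfolding deg_bounded_def by (blast intro: order_trans)

lemma deg_bounded_times_single:
  fixes P :: "('v \<Rightarrow>\<^sub>0 nat) \<Rightarrow>\<^sub>0 'k::comm_ring_1"
  assumes "deg_bounded V d P" "Poly_Mapping.keys t \<subseteq> V" "d + total_deg t \<le> e"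
  shows "deg_bounded V e (P * Poly_Mapping.single t c)"
  unfolding deg_bounded_def
proof
  fix m assume "m \<in> Poly_Mapping.keys (P * Poly_Mapping.single t c)"
  then obtain k where "k \<in> Poly_Mapping.keys P" "m = k + t"
    using keys_mult[of P "Poly_Mapping.single t c"] by (auto split: if_splits)
  then show "total_deg m \<le> e \<and> Poly_Mapping.keys m \<subseteq> V"
    using assms unfolding deg_bounded_def by (fastforce simp: keys_plus_nat)
qed

lemma deg_bounded_lookup:
  "deg_bounded V d P \<Longrightarrow> d < total_deg m \<Longrightarrow> Poly_Mapping.lookup P m = 0"
  unfolding deg_bounded_def by (meson in_keys_iff leD)


section \<open>Translation of relations\<close>

text \<open>The algebraic core: \<open>\<sigma>\<^sub>S\<close> extends \<open>\<sigma>\<close> and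
  shifts the values of finitely many variables by elements of the base field. One polynomial
  involves only finitely many variables, so \<open>V\<close> can be finite and sums over it make
  sense.\<close>

locale translation =
  fixes \<sigma> :: "'k::field_char_0 \<Rightarrow> 'k" and \<sigma>\<^sub>S :: "'s::comm_ring_1 \<Rightarrow> 's" and \<iota> :: "'k \<Rightarrow> 's"
    and V :: "'v set" and x :: "'v \<Rightarrow> 's" and b :: "'v \<Rightarrow> 'k"
  assumes \<sigma>_add: "\<sigma> (p + q) = \<sigma> p + \<sigma> q"
    and \<sigma>_one: "\<sigma> 1 = 1"
    and \<sigma>\<^sub>S_add: "\<sigma>\<^sub>S (r + s) = \<sigma>\<^sub>S r + \<sigma>\<^sub>S s"
    and \<sigma>\<^sub>S_mult: "\<sigma>\<^sub>S (r * s) = \<sigma>\<^sub>S r * \<sigma>\<^sub>S s"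
    and \<iota>_add: "\<iota> (p + q) = \<iota> p + \<iota> q"
    and \<iota>_mult: "\<iota> (p * q) = \<iota> p * \<iota> q"
    and \<iota>_one: "\<iota> 1 = 1"
    and \<iota>_inj: "inj \<iota>"
    and \<iota>_\<sigma>: "\<iota> (\<sigma> p) = \<sigma>\<^sub>S (\<iota> p)"
    and finite_V: "finite V"
    and \<sigma>\<^sub>S_x: "v \<in> V \<Longrightarrow> \<sigma>\<^sub>S (x v) = x v + \<iota> (b v)"
begin

section \<open>Rules for evaluation\<close>

abbreviation ev :: "(('v \<Rightarrow>\<^sub>0 nat) \<Rightarrow>\<^sub>0 'k) \<Rightarrow> 's" where
  "ev \<equiv> poly_eval \<iota> x"

lemma \<sigma>_zero [simp]: "\<sigma> 0 = 0"
  using \<sigma>_add[of 0 0] by simp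

lemma \<sigma>\<^sub>S_zero [simp]: "\<sigma>\<^sub>S 0 = 0"
  using \<sigma>\<^sub>S_add[of 0 0] by simp

lemma \<iota>_zero [simp]: "\<iota> 0 = 0"
  using \<iota>_add[of 0 0] by simp

lemma ev_zero [simp]: "ev 0 = 0"
  by (simp add: poly_eval_def)

lemma ev_add: "ev (P + Q) = ev P + ev Q"
  unfolding poly_eval_def
  by (rule setsum_keys_plus_distrib) (auto simp: \<iota>_add distrib_right)

lemma ev_diff: "ev (P - Q) = ev P - ev Q"
  using ev_add[of "P - Q" Q] by simp

lemma ev_single: "ev (Poly_Mapping.single m c) = \<iota> c * mono_eval x m"
  by (cases "c = 0") (auto simp: poly_eval_def)

lemma ev_sum: "ev (\<Sum>i\<in>A. P i) = (\<Sum>i\<in>A. ev (P i))"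
  by (induction A rule: infinite_finite_induct) (auto simp: ev_add)

lemma ev_times_single: "ev (P * Poly_Mapping.single t c) = ev P * (\<iota> c * mono_eval x t)"
proof -
  have "ev (P * Poly_Mapping.single t c) =
      ev (\<Sum>m\<in>Poly_Mapping.keys P. Poly_Mapping.single (m + t) (Poly_Mapping.lookup P m * c))"
    by (subst poly_mapping_eq_sum_single[of P]) (simp add: sum_distrib_right mult_single)
  also have "\<dots> = ev P * (\<iota> c * mono_eval x t)"
    by (simp add: ev_sum ev_single \<iota>_mult mono_eval_plus sum_distrib_left sum_distrib_right
        poly_eval_def[of _ _ P] mult_ac)
  finally show ?thesis .
qed

text \<open>\<open>Q\<close> plays the role of \<open>P\<^sup>\<sigma>(X + b)\<close>, of which only the coefficients in degrees \<open>d\<close> and \<open>d - 1\<close>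
  matter.\<close>

definition is_translate ::
  "nat \<Rightarrow> (('v \<Rightarrow>\<^sub>0 nat) \<Rightarrow>\<^sub>0 'k) \<Rightarrow> (('v \<Rightarrow>\<^sub>0 nat) \<Rightarrow>\<^sub>0 'k) \<Rightarrow> bool" where
  "is_translate d P Q \<longleftrightarrow> deg_bounded V d Q \<and> ev Q = \<sigma>\<^sub>S (ev P) \<and>
     (\<forall>m. total_deg m = d \<longrightarrow> Poly_Mapping.lookup Q m = \<sigma> (Poly_Mapping.lookup P m)) \<and>
     (\<forall>m. Suc (total_deg m) = d \<longrightarrow> Poly_Mapping.lookup Q m = \<sigma> (Poly_Mapping.lookup P m) +
        (\<Sum>v\<in>V. of_nat (Suc (Poly_Mapping.lookup m v)) * b v *
           \<sigma> (Poly_Mapping.lookup P (m + Var v))))"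

section \<open>Construction of translates\<close>

lemma is_translate_zero: "is_translate d 0 0"
  by (simp add: is_translate_def)

lemma is_translate_add:
  assumes "is_translate d P Q" "is_translate d P' Q'"
  shows "is_translate d (P + P') (Q + Q')"
  using assms unfolding is_translate_def
  by (auto simp: deg_bounded_plus ev_add \<sigma>\<^sub>S_add \<sigma>_add lookup_add sum.distrib distrib_left)

text \<open>In degree \<open>Suc d\<close> both polynomials vanish. In degree \<open>d\<close> the
  correction sum only sees coefficients of \<open>P\<close> in degree \<open>Suc d\<close>, so it
  vanishes as well, and the old top condition becomes the new subleading one.\<close>

lemma is_translate_Suc:
  assumes "is_translate d P Q" "deg_bounded V d P"
  shows "is_translate (Suc d) P Q"
proof -
  have "deg_bounded V d Q"
    using assms unfolding is_translate_def by blast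
  then show ?thesis
    using assms unfolding is_translate_def
    by (auto simp: deg_bounded_lookup intro: deg_bounded_mono)
qed

text \<open>The variable \<open>v\<close> turns into itself plus \<open>b v\<close>, and the
  correction sum obeys a product rule: one part is inherited from \<open>P\<close>, the other is
  \<open>b v\<close> times a top coefficient.\<close>

lemma is_translate_times_var:
  assumes PQ: "is_translate d P Q" and P: "deg_bounded V d P" and v: "v \<in> V"
  shows "is_translate (Suc d) (P * Poly_Mapping.single (Var v) 1)
    (Q * Poly_Mapping.single (Var v) 1 + Q * Poly_Mapping.single 0 (b v))"
    (is "is_translate _ ?P ?Q")
proof -
  have Q: "deg_bounded V d Q" and evQ: "ev Q = \<sigma>\<^sub>S (ev P)"
    and top: "\<And>m. total_deg m = d \<Longrightarrow> Poly_Mapping.lookup Q m = \<sigma> (Poly_Mapping.lookup P m)"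
    and sub: "\<And>m. Suc (total_deg m) = d \<Longrightarrow> Poly_Mapping.lookup Q m =
       \<sigma> (Poly_Mapping.lookup P m) + (\<Sum>v\<in>V. of_nat (Suc (Poly_Mapping.lookup m v)) * b v *
           \<sigma> (Poly_Mapping.lookup P (m + Var v)))"
    using PQ unfolding is_translate_def by blast+
  have "deg_bounded V (Suc d) ?Q"
    using v by (intro deg_bounded_plus deg_bounded_times_single[OF Q]) auto
  moreover have "ev ?Q = \<sigma>\<^sub>S (ev ?P)"
    using v by (simp add: ev_add ev_times_single evQ \<iota>_one \<sigma>\<^sub>S_mult \<sigma>\<^sub>S_x distrib_left)
  \<comment> \<open>The multiple of \<open>Q\<close> by the constant \<open>b v\<close> has degree
    at most \<open>d\<close>, so it does not reach degree \<open>Suc d\<close>.\<close>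
  moreover have "Poly_Mapping.lookup ?Q m = \<sigma> (Poly_Mapping.lookup ?P m)"
    if m: "total_deg m = Suc d" for m
  proof (cases "v \<in> Poly_Mapping.keys m")
    case True
    then obtain k where k: "m = k + Var v" by (rule obtain_var_factor)
    with m have "total_deg k = d" by simp
    with m top[of k] show ?thesis
      using deg_bounded_lookup[OF Q, of m]
      by (simp add: lookup_add lookup_times_const) (simp add: k lookup_times_single_plus)
  next
    case False
    with m show ?thesis
      using deg_bounded_lookup[OF Q, of m]
      by (simp add: lookup_add lookup_times_const lookup_times_var_eq_0 in_keys_iff)
  qed
  moreover have "Poly_Mapping.lookup ?Q m = \<sigma> (Poly_Mapping.lookup ?P m) +
      (\<Sum>u\<in>V. of_nat (Suc (Poly_Mapping.lookup m u)) * b u * \<sigma> (Poly_Mapping.lookup ?P (m + Var u)))"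
    if m: "total_deg m = d" for m
  proof (cases "v \<in> Poly_Mapping.keys m")
    case True
    then obtain k where k: "m = k + Var v" by (rule obtain_var_factor)
    with m have deg_k: "Suc (total_deg k) = d" by simp
    have "Poly_Mapping.lookup ?P (m + Var u) = Poly_Mapping.lookup P (k + Var u)" for u
      using lookup_times_single_plus[of P "Var v" 1 "k + Var u"] by (simp add: k ac_simps)
    \<comment> \<open>Passing from \<open>k\<close> to \<open>m\<close> raises the exponent of
      \<open>v\<close> by one. The extra term this creates is exactly the contribution of the
      constant \<open>b v\<close> to \<open>?Q\<close>.\<close>
    then have "(\<Sum>u\<in>V. of_nat (Suc (Poly_Mapping.lookup m u)) * b u *
          \<sigma> (Poly_Mapping.lookup ?P (m + Var u))) =
        (\<Sum>u\<in>V. of_nat (Suc (Poly_Mapping.lookup k u)) * b u *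
          \<sigma> (Poly_Mapping.lookup P (k + Var u)) +
          (if u = v then b v * \<sigma> (Poly_Mapping.lookup P m) else 0))"
      by (intro sum.cong) (auto simp: k lookup_add lookup_single when_def algebra_simps)
    also have "\<dots> = (\<Sum>u\<in>V. of_nat (Suc (Poly_Mapping.lookup k u)) * b u *
          \<sigma> (Poly_Mapping.lookup P (k + Var u))) + b v * \<sigma> (Poly_Mapping.lookup P m)"
      using v finite_V by (simp add: sum.distrib)
    finally show ?thesis
      using top[OF m] sub[OF deg_k]
      by (simp add: lookup_add lookup_times_const)
         (simp add: k lookup_times_single_plus algebra_simps)
  next
    case False
    then have mv: "Poly_Mapping.lookup m v = 0" by (simp add: in_keys_iff)
    \<comment> \<open>Every monomial of \<open>?P\<close> is divisible by \<open>v\<close>, and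
      \<open>m\<close> is not, so only \<open>u = v\<close> contributes, with factor
      \<open>Suc 0\<close>.\<close>
    have "Poly_Mapping.lookup ?P (m + Var u) =
        (if u = v then Poly_Mapping.lookup P m else 0)" for u
    proof (cases "u = v")
      case True
      then show ?thesis using lookup_times_single_plus[of P "Var v" 1 m] by simp
    next
      case False
      with mv show ?thesis
        by (simp add: lookup_times_var_eq_0 lookup_add lookup_single)
    qed
    then have "(\<Sum>u\<in>V. of_nat (Suc (Poly_Mapping.lookup m u)) * b u *
          \<sigma> (Poly_Mapping.lookup ?P (m + Var u))) =
        (\<Sum>u\<in>V. if u = v then b v * \<sigma> (Poly_Mapping.lookup P m) else 0)"
      by (intro sum.cong) (auto simp: mv)
    then show ?thesis
      using v finite_V mv top[OF m]
      by (simp add: lookup_add lookup_times_const lookup_times_var_eq_0)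
  qed
  ultimately show ?thesis
    unfolding is_translate_def by blast
qed

text \<open>Induction on the bound: a monomial of smaller degree keeps its translate, and one of
  degree \<open>Suc d\<close> is a variable times a monomial of degree \<open>d\<close>.\<close>

lemma ex_translate_single:
  assumes "Poly_Mapping.keys m \<subseteq> V" "total_deg m \<le> d"
  shows "\<exists>Q. is_translate d (Poly_Mapping.single m c) Q"
  using assms
proof (induction d arbitrary: m)
  case 0
  then have "m = 0" by simp
  moreover have "is_translate 0 (Poly_Mapping.single 0 c) (Poly_Mapping.single 0 (\<sigma> c))"
    by (auto simp: is_translate_def deg_bounded_def ev_single \<iota>_\<sigma>)
  ultimately show ?case by blast
next
  case (Suc d)
  have bounded: "deg_bounded V d (Poly_Mapping.single k c)"
    if "Poly_Mapping.keys k \<subseteq> V" "total_deg k \<le> d" for k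
    using that by (simp add: deg_bounded_def)
  show ?case
  proof (cases "total_deg m \<le> d")
    case True
    with Suc bounded show ?thesis by (blast intro: is_translate_Suc)
  next
    case False
    then have "m \<noteq> 0" by auto
    then obtain v where v: "v \<in> Poly_Mapping.keys m"
      by (metis ex_in_conv keys_eq_empty)
    then obtain k where k: "m = k + Var v" by (rule obtain_var_factor)
    with Suc.prems have "Poly_Mapping.keys k \<subseteq> V" "total_deg k \<le> d" "v \<in> V"
      using v by (auto simp: keys_plus_nat)
    with Suc.IH[of k] obtain Q where "is_translate d (Poly_Mapping.single k c) Q" by blast
    from is_translate_times_var[OF this bounded \<open>v \<in> V\<close>] \<open>Poly_Mapping.keys k \<subseteq> V\<close> \<open>total_deg k \<le> d\<close>
    show ?thesis by (auto simp: k mult_single)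
  qed
qed

lemma ex_translate:
  assumes "deg_bounded V d P"
  shows "\<exists>Q. is_translate d P Q"
proof -
  \<comment> \<open>The index set grows while the coefficients stay those of the fixed
    \<open>P\<close>.\<close>
  have "\<exists>Q. is_translate d (\<Sum>m\<in>A. Poly_Mapping.single m (Poly_Mapping.lookup P m)) Q"
    if "finite A" "A \<subseteq> Poly_Mapping.keys P" for A
    using that
  proof (induction A)
    case empty
    then show ?case using is_translate_zero by auto
  next
    case (insert m A)
    moreover have "\<exists>Q. is_translate d (Poly_Mapping.single m (Poly_Mapping.lookup P m)) Q"
      using assms insert.prems by (intro ex_translate_single) (auto simp: deg_bounded_def)
    ultimately show ?case by (auto intro: is_translate_add)
  qed
  from this[of "Poly_Mapping.keys P"] show ?thesis
    using poly_mapping_eq_sum_single[of P] by simp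
qed

section \<open>Minimal relations and the linear identity\<close>

lemma minimal_relation:
  assumes "deg_bounded V e P" "P \<noteq> 0" "ev P = 0"
  obtains d P m where "is_translate d P P" "deg_bounded V d P" "ev P = 0"
    "total_deg m = d" "Poly_Mapping.lookup P m = 1"
proof -
  define rel where "rel d P \<longleftrightarrow> deg_bounded V d P \<and> P \<noteq> 0 \<and> ev P = 0" for d P
  define top where "top d P = {m \<in> Poly_Mapping.keys P. total_deg m = d}"
    for d and P :: "('v \<Rightarrow>\<^sub>0 nat) \<Rightarrow>\<^sub>0 'k"
  define d where "d = (LEAST d. \<exists>P. rel d P)"
  have "\<exists>P. rel e P" using assms by (auto simp: rel_def)
  then have "\<exists>P. rel d P" unfolding d_def by (rule LeastI[of "\<lambda>d. \<exists>P. rel d P"])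
  then obtain P\<^sub>0 where P\<^sub>0: "rel d P\<^sub>0" and min: "\<And>P. rel d P \<Longrightarrow> card (top d P\<^sub>0) \<le> card (top d P)"
    by (metis ex_has_least_nat[of "rel d" _ "\<lambda>P. card (top d P)"])
  have d_le: "d \<le> d'" if "rel d' P" for d' P
    unfolding d_def using that by (intro Least_le) blast
  \<comment> \<open>Otherwise the bound \<open>d - 1\<close> would do. The nonzero
    \<open>P\<^sub>0\<close> has some monomial, of degree below \<open>d\<close>, so
    \<open>d\<close> is positive and the natural subtraction really decreases it.\<close>
  have "top d P\<^sub>0 \<noteq> {}"
  proof
    assume empty: "top d P\<^sub>0 = {}"
    have lt: "total_deg m < d" if "m \<in> Poly_Mapping.keys P\<^sub>0" for m
      using that empty P\<^sub>0 by (force simp: top_def rel_def deg_bounded_def)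
    obtain m where "m \<in> Poly_Mapping.keys P\<^sub>0"
      using P\<^sub>0 by (metis ex_in_conv keys_eq_empty rel_def)
    with lt have "d - 1 < d" by fastforce
    moreover have "rel (d - 1) P\<^sub>0"
      using lt P\<^sub>0 unfolding rel_def deg_bounded_def by fastforce
    ultimately show False using d_le by fastforce
  qed
  then obtain m where m: "m \<in> Poly_Mapping.keys P\<^sub>0" "total_deg m = d"
    by (auto simp: top_def)
  \<comment> \<open>Scaling by a nonzero constant keeps the support, so the count of top monomials
    stays minimal.\<close>
  define P where "P = P\<^sub>0 * Poly_Mapping.single 0 (inverse (Poly_Mapping.lookup P\<^sub>0 m))"
  have lookup_P: "Poly_Mapping.lookup P k =
      Poly_Mapping.lookup P\<^sub>0 k * inverse (Poly_Mapping.lookup P\<^sub>0 m)" for k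
    by (simp add: P_def lookup_times_const)
  have keys_P: "Poly_Mapping.keys P = Poly_Mapping.keys P\<^sub>0"
    using m by (auto simp: in_keys_iff lookup_P)
  have P: "deg_bounded V d P" "ev P = 0" "Poly_Mapping.lookup P m = 1"
    using P\<^sub>0 m by (auto simp: rel_def deg_bounded_def keys_P lookup_P in_keys_iff)
      (simp add: P_def ev_times_single)
  obtain Q where Q: "is_translate d P Q"
    using ex_translate[OF P(1)] by blast
  have "\<not> rel d (Q - P)"
  proof
    assume "rel d (Q - P)"
    then have "card (top d P\<^sub>0) \<le> card (top d (Q - P))" by (rule min)
    moreover have "Poly_Mapping.lookup Q k = \<sigma> (Poly_Mapping.lookup P k)" if "total_deg k = d" for k
      using Q that by (simp add: is_translate_def)
    \<comment> \<open>Since \<open>\<sigma> 0 = 0\<close>, no new top monomial arises; since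
      \<open>\<sigma> 1 = 1\<close>, the coefficient at \<open>m\<close> cancels.\<close>
    then have "top d (Q - P) \<subseteq> top d P\<^sub>0 - {m}"
      using P(3) keys_P by (auto simp: top_def in_keys_iff lookup_minus \<sigma>_one)
    moreover have "top d P\<^sub>0 - {m} \<subset> top d P\<^sub>0"
      using m by (auto simp: top_def)
    moreover have "finite (top d P\<^sub>0)" by (simp add: top_def)
    ultimately show False
      by (meson leD order.strict_trans1 psubset_card_mono)
  qed
  \<comment> \<open>All conditions of \<open>rel\<close> except being nonzero hold for
    \<open>Q - P\<close>, so it must be zero.\<close>
  moreover have "deg_bounded V d (Q - P)" "ev (Q - P) = 0"
    using Q P by (auto simp: is_translate_def ev_diff intro: deg_bounded_minus)
  ultimately have "Q = P" by (auto simp: rel_def)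
  with Q P m(2) that show thesis by blast
qed

lemma linear_relation:
  assumes "deg_bounded V e P" "P \<noteq> 0" "ev P = 0"
  obtains c f u where "u \<in> V" "c u \<noteq> 0" "\<And>v. v \<in> V \<Longrightarrow> \<sigma> (c v) = c v"
    "(\<Sum>v\<in>V. c v * b v) = \<sigma> f - f"
proof -
  obtain d P m where P: "is_translate d P P" "deg_bounded V d P" "ev P = 0"
    and m: "total_deg m = d" "Poly_Mapping.lookup P m = 1"
    using minimal_relation[OF assms] .
  have top: "\<sigma> (Poly_Mapping.lookup P k) = Poly_Mapping.lookup P k" if "total_deg k = d" for k
    using P(1) that by (metis is_translate_def)
  \<comment> \<open>In degree 0 the relation would be the constant 1, whose value is nonzero as
    \<open>\<iota>\<close> is injective.\<close>
  have "d \<noteq> 0"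
  proof
    assume "d = 0"
    then have keys: "Poly_Mapping.keys P \<subseteq> {0}" and "m = 0"
      using P(2) m(1) by (auto simp: deg_bounded_def)
    then have "ev P = \<iota> 1"
      using m(2) by (simp add: poly_eval_def sum.mono_neutral_left[OF _ keys] in_keys_iff)
    with P(3) \<iota>_inj \<iota>_zero show False by (metis injD zero_neq_one)
  qed
  then have "m \<noteq> 0" using m by auto
  then obtain u where u: "u \<in> Poly_Mapping.keys m"
    by (metis ex_in_conv keys_eq_empty)
  then obtain k where k: "m = k + Var u" by (rule obtain_var_factor)
  have deg_k: "Suc (total_deg k) = d" using m k by simp
  \<comment> \<open>This is the coefficient at \<open>k\<close> of the partial derivative of
    \<open>P\<close> with respect to \<open>v\<close>.\<close>
  define c where "c v = of_nat (Suc (Poly_Mapping.lookup k v)) * Poly_Mapping.lookup P (k + Var v)" for v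
  show thesis
  proof
    show "u \<in> V"
      using u m(2) P(2) unfolding deg_bounded_def by (metis in_keys_iff subsetD zero_neq_one)
    \<comment> \<open>\<open>c u\<close> is the exponent of \<open>u\<close> in \<open>m\<close>
      times the coefficient 1, which is nonzero in characteristic 0.\<close>
    show "c u \<noteq> 0"
      using m k by (simp add: c_def del: of_nat_Suc)
    show "\<sigma> (c v) = c v" for v
    proof -
      have mult: "\<sigma> (of_nat j * q) = of_nat j * \<sigma> q" for j q
        by (induction j) (auto simp: \<sigma>_add algebra_simps)
      show ?thesis
        unfolding c_def mult using deg_k by (simp add: top)
    qed
    have "Poly_Mapping.lookup P k = \<sigma> (Poly_Mapping.lookup P k) +
        (\<Sum>v\<in>V. of_nat (Suc (Poly_Mapping.lookup k v)) * b v * \<sigma> (Poly_Mapping.lookup P (k + Var v)))"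
      using P(1) deg_k unfolding is_translate_def by blast
    also have "(\<Sum>v\<in>V. of_nat (Suc (Poly_Mapping.lookup k v)) * b v *
        \<sigma> (Poly_Mapping.lookup P (k + Var v))) = (\<Sum>v\<in>V. c v * b v)"
      using deg_k by (intro sum.cong) (auto simp: c_def top)
    finally have "Poly_Mapping.lookup P k = \<sigma> (Poly_Mapping.lookup P k) + (\<Sum>v\<in>V. c v * b v)" .
    moreover have "\<sigma> (- Poly_Mapping.lookup P k) = - \<sigma> (Poly_Mapping.lookup P k)"
      using \<sigma>_add[of "- Poly_Mapping.lookup P k" "Poly_Mapping.lookup P k"]
      by (simp add: eq_neg_iff_add_eq_0)
    ultimately show "(\<Sum>v\<in>V. c v * b v) = \<sigma> (- Poly_Mapping.lookup P k) - (- Poly_Mapping.lookup P k)"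
      by (simp add: algebra_simps)
  qed
qed

end

section \<open>Application to difference-differential rings\<close>

theorem proposition3p1:
  fixes \<sigma> \<delta> :: "'k::field_char_0 \<Rightarrow> 'k"
    and \<sigma>\<^sub>S \<delta>\<^sub>S :: "'s::comm_ring_1 \<Rightarrow> 's"
    and \<iota> :: "'k \<Rightarrow> 's"
    and n :: nat
    and a :: "nat \<Rightarrow> 'k"
    and z :: "nat \<Rightarrow> 's"
  assumes "sigma_delta_ring \<sigma> \<delta>"
    and "differentially_closed (invariants \<sigma>) \<delta>"
    and "sigma_delta_ring \<sigma>\<^sub>S \<delta>\<^sub>S"
    and "sigma_delta_inclusion \<sigma> \<delta> \<sigma>\<^sub>S \<delta>\<^sub>S \<iota>"
    and "invariants \<sigma>\<^sub>S = \<iota> ` invariants \<sigma>"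
    and "\<And>i. i \<in> {1..n} \<Longrightarrow> \<sigma>\<^sub>S (z i) - z i = \<iota> (a i)"
  shows "differentially_dependent \<iota> \<delta>\<^sub>S n z \<longleftrightarrow>
    (\<exists>L \<in> diff_polys (invariants \<sigma>) n. \<exists>f.
       L \<noteq> 0 \<and> homogeneous_linear L \<and> diff_eval id \<delta> L a = \<sigma> f - f)"
proof -
  define x where "x = (\<lambda>(i, j). (\<delta>\<^sub>S ^^ j) (z i))"
  define b where "b = (\<lambda>(i, j). (\<delta> ^^ j) (a i))"
  have \<sigma>: "\<And>p q. \<sigma> (p + q) = \<sigma> p + \<sigma> q" "\<sigma> 1 = 1"
    using assms(1) by (auto simp: sigma_delta_ring_def ring_automorphism_def)
  have \<sigma>\<^sub>S: "\<And>r s. \<sigma>\<^sub>S (r + s) = \<sigma>\<^sub>S r + \<sigma>\<^sub>S s" "\<And>r s. \<sigma>\<^sub>S (r * s) = \<sigma>\<^sub>S r * \<sigma>\<^sub>S s"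
    and \<delta>\<^sub>S_add: "\<And>r s. \<delta>\<^sub>S (r + s) = \<delta>\<^sub>S r + \<delta>\<^sub>S s" and commute: "\<And>r. \<sigma>\<^sub>S (\<delta>\<^sub>S r) = \<delta>\<^sub>S (\<sigma>\<^sub>S r)"
    using assms(3) by (auto simp: sigma_delta_ring_def ring_automorphism_def derivation_def)
  have \<iota>: "\<And>p q. \<iota> (p + q) = \<iota> p + \<iota> q" "\<And>p q. \<iota> (p * q) = \<iota> p * \<iota> q" "\<iota> 1 = 1" "inj \<iota>"
    "\<And>p. \<iota> (\<sigma> p) = \<sigma>\<^sub>S (\<iota> p)" and \<iota>_\<delta>: "\<And>p. \<iota> (\<delta> p) = \<delta>\<^sub>S (\<iota> p)"
    using assms(4) by (auto simp: sigma_delta_inclusion_def)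
  have x_translate: "\<sigma>\<^sub>S (x v) = x v + \<iota> (b v)" if v: "v \<in> {1..n} \<times> UNIV" for v
  proof -
    obtain i j where [simp]: "v = (i, j)" and i: "i \<in> {1..n}" using v by auto
    \<comment> \<open>Differentiating the equation for \<open>j\<close> gives the one for
      \<open>Suc j\<close>, because \<open>\<delta>\<^sub>S\<close> is additive and compatible with
      \<open>\<sigma>\<^sub>S\<close> and \<open>\<iota>\<close>.\<close>
    have "\<sigma>\<^sub>S ((\<delta>\<^sub>S ^^ j) (z i)) = (\<delta>\<^sub>S ^^ j) (z i) + \<iota> ((\<delta> ^^ j) (a i))"
    proof (induction j)
      case 0
      show ?case using assms(6)[OF i] by (simp add: algebra_simps)
    next
      case (Suc j)
      then show ?case by (simp add: commute \<delta>\<^sub>S_add \<iota>_\<delta>)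
    qed
    then show ?thesis by (simp add: x_def b_def)
  qed
  have translation: "translation \<sigma> \<sigma>\<^sub>S \<iota> V x b" if "finite V" "V \<subseteq> {1..n} \<times> UNIV" for V
    using that x_translate by unfold_locales (auto simp: \<sigma> \<sigma>\<^sub>S \<iota>)
  have eval_z: "diff_eval \<iota> \<delta>\<^sub>S P z = poly_eval \<iota> x P" for P
    unfolding x_def by (rule diff_eval_eq_poly_eval)
  have eval_a: "diff_eval id \<delta> L a = poly_eval id b L" for L
    unfolding b_def by (rule diff_eval_eq_poly_eval)
  show ?thesis
  proof
    assume "differentially_dependent \<iota> \<delta>\<^sub>S n z"
    then obtain P where P: "P \<in> diff_polys UNIV n" "P \<noteq> 0" "poly_eval \<iota> x P = 0"
      by (auto simp: differentially_dependent_def eval_z)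
    \<comment> \<open>\<open>V\<close> collects the variables occurring in \<open>P\<close>; the sum
      \<open>e\<close> of all degrees is a convenient degree bound.\<close>
    define V where "V = (\<Union>m\<in>Poly_Mapping.keys P. Poly_Mapping.keys m)"
    define e where "e = (\<Sum>m\<in>Poly_Mapping.keys P. total_deg m)"
    have finite: "finite V" by (simp add: V_def)
    have V: "V \<subseteq> {1..n} \<times> UNIV"
      using P(1) by (auto simp: V_def diff_polys_def)
    interpret translation \<sigma> \<sigma>\<^sub>S \<iota> V x b
      using finite V by (rule translation)
    have "deg_bounded V e P"
      by (auto simp: deg_bounded_def V_def e_def intro: member_le_sum)
    then obtain c f u where u: "u \<in> V" "c u \<noteq> 0" and c: "\<And>v. v \<in> V \<Longrightarrow> \<sigma> (c v) = c v"
      and f: "(\<Sum>v\<in>V. c v * b v) = \<sigma> f - f"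
      using linear_relation[OF _ P(2,3)] by metis
    define L where "L = (\<Sum>v\<in>V. Poly_Mapping.single (Var v) (c v))"
    have lookup_L: "Poly_Mapping.lookup L (Var v) = c v" if "v \<in> V" for v
      using that finite by (simp add: L_def lookup_sum lookup_single when_def)
    have keys_L: "Poly_Mapping.keys L \<subseteq> Var ` V"
      unfolding L_def using keys_sum[of "\<lambda>v. Poly_Mapping.single (Var v) (c v)" V]
      by (auto split: if_splits)
    have "L \<in> diff_polys (invariants \<sigma>) n"
      unfolding diff_polys_def invariants_def
    proof (intro CollectI ballI conjI)
      fix m assume "m \<in> Poly_Mapping.keys L"
      then obtain v where "v \<in> V" "m = Var v" using keys_L by blast
      with V show "\<sigma> (Poly_Mapping.lookup L m) = Poly_Mapping.lookup L m"
        and "Poly_Mapping.keys m \<subseteq> {1..n} \<times> UNIV"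
        by (auto simp: lookup_L c)
    qed
    moreover have "L \<noteq> 0"
      using lookup_L[OF u(1)] u(2) by auto
    moreover have "homogeneous_linear L"
      using keys_L by (auto simp: homogeneous_linear_def)
    moreover have "diff_eval id \<delta> L a = \<sigma> f - f"
    proof -
      \<comment> \<open>Some \<open>c v\<close> may be 0, so the sum is first extended from the
        support of \<open>L\<close> to all of \<open>V\<close> by zero terms.\<close>
      have "poly_eval id b L = (\<Sum>m\<in>Var ` V. Poly_Mapping.lookup L m * mono_eval b m)"
        unfolding poly_eval_def using keys_L finite
        by (intro sum.mono_neutral_cong_left) (auto simp: in_keys_iff)
      also have "\<dots> = (\<Sum>v\<in>V. c v * b v)"
        by (subst sum.reindex) (auto simp: inj_on_def lookup_L)
      finally show ?thesis by (simp add: eval_a f)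
    qed
    ultimately show "\<exists>L \<in> diff_polys (invariants \<sigma>) n. \<exists>f.
       L \<noteq> 0 \<and> homogeneous_linear L \<and> diff_eval id \<delta> L a = \<sigma> f - f" by blast
  next
    assume "\<exists>L \<in> diff_polys (invariants \<sigma>) n. \<exists>f.
       L \<noteq> 0 \<and> homogeneous_linear L \<and> diff_eval id \<delta> L a = \<sigma> f - f"
    then obtain L f where L: "L \<in> diff_polys (invariants \<sigma>) n" "L \<noteq> 0" "homogeneous_linear L"
      and f: "poly_eval id b L = \<sigma> f - f"
      by (auto simp: eval_a)
    \<comment> \<open>Only the evaluation rules are wanted here; the shift itself comes from
      \<open>x_translate\<close>.\<close>
    interpret translation \<sigma> \<sigma>\<^sub>S \<iota> "{}" x b
      by (rule translation) auto
    have \<sigma>\<^sub>S_sum: "\<sigma>\<^sub>S (\<Sum>m\<in>A. g m) = (\<Sum>m\<in>A. \<sigma>\<^sub>S (g m))" for A and g :: "(nat \<times> nat \<Rightarrow>\<^sub>0 nat) \<Rightarrow> 's"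
      by (induction A rule: infinite_finite_induct) (auto simp: \<sigma>\<^sub>S)
    have \<iota>_sum: "\<iota> (\<Sum>m\<in>A. g m) = (\<Sum>m\<in>A. \<iota> (g m))" for A and g :: "(nat \<times> nat \<Rightarrow>\<^sub>0 nat) \<Rightarrow> 'k"
      by (induction A rule: infinite_finite_induct) (auto simp: \<iota>)
    \<comment> \<open>The monomial is a single variable and its coefficient is invariant, so the
      shift produces no cross terms.\<close>
    have summand: "\<sigma>\<^sub>S (\<iota> (Poly_Mapping.lookup L m) * mono_eval x m) =
        \<iota> (Poly_Mapping.lookup L m) * mono_eval x m + \<iota> (Poly_Mapping.lookup L m * mono_eval b m)"
      if m: "m \<in> Poly_Mapping.keys L" for m
    proof -
      obtain v where v: "m = Var v" using L(3) m by (auto simp: homogeneous_linear_def)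
      have "\<sigma> (Poly_Mapping.lookup L m) = Poly_Mapping.lookup L m" "v \<in> {1..n} \<times> UNIV"
        using L(1) m v by (auto simp: diff_polys_def invariants_def)
      then show ?thesis
        by (simp add: v \<sigma>\<^sub>S x_translate \<iota> distrib_left flip: \<iota>(5))
    qed
    have "\<sigma>\<^sub>S (ev L) = ev L + \<iota> (poly_eval id b L)"
      unfolding poly_eval_def by (simp add: \<sigma>\<^sub>S_sum \<iota>_sum summand sum.distrib)
    also have "\<dots> = ev L + \<sigma>\<^sub>S (\<iota> f) - \<iota> f"
      using \<iota>(1)[of "\<sigma> f - f" f] by (simp add: f \<iota>(5) algebra_simps)
    finally have "\<sigma>\<^sub>S (ev L - \<iota> f) = ev L - \<iota> f"
      using \<sigma>\<^sub>S(1)[of "ev L - \<iota> f" "\<iota> f"] by (simp add: algebra_simps)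
    \<comment> \<open>The hypothesis on invariants enters: an invariant of \<open>S\<close> comes
      from an invariant of the base field.\<close>
    then obtain c where c: "ev L - \<iota> f = \<iota> c"
      using assms(5) by (force simp: invariants_def)
    define P where "P = L - Poly_Mapping.single 0 (f + c)"
    have "ev P = 0"
      using c by (simp add: P_def ev_diff ev_single \<iota> algebra_simps)
    moreover have "P \<noteq> 0"
    proof -
      obtain m where m: "m \<in> Poly_Mapping.keys L"
        using L(2) by (metis ex_in_conv keys_eq_empty)
      \<comment> \<open>All monomials of \<open>L\<close> have degree 1, so subtracting a constant
        cannot cancel them.\<close>
      with L(3) have "m \<noteq> 0"
        by (metis homogeneous_linear_def total_deg_single total_deg_zero zero_neq_one)
      with m have "Poly_Mapping.lookup P m \<noteq> 0"
        by (simp add: P_def lookup_minus lookup_single in_keys_iff)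
      then show ?thesis by auto
    qed
    moreover have "P \<in> diff_polys UNIV n"
    proof -
      \<comment> \<open>The added monomial 0 contains no variable, so the condition on variables
        holds for it trivially.\<close>
      have "m \<in> Poly_Mapping.keys L \<or> m = 0" if "m \<in> Poly_Mapping.keys P" for m
        using that by (auto simp: P_def in_keys_iff lookup_minus lookup_single when_def split: if_splits)
      then show ?thesis using L(1) by (fastforce simp: diff_polys_def)
    qed
    ultimately show "differentially_dependent \<iota> \<delta>\<^sub>S n z"
      by (auto simp: differentially_dependent_def eval_z)
  qed
qed

end
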